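(* Let $X$ be a real Hilbert space. For all $\eta:(0,\infty) \to (0,\infty)$ and $L_1,L_2,L_3 > 0$ put \begin{align*} \rho(\eta,L_1,L_2,L_3) &:= 2L_3 + L_1L_3 + \eta(2L_1+2L_2+2),\\ \Theta(\eta,L_1,L_2,L_3)&:=(L_1+L_2) (L_3 + \rho(\eta,L_1,L_2,L_3)). \end{align*} Let $\eta:(0,\infty) \to (0,\infty)$, $L_1,L_2,L_3 > 0$ and let $A: X \to X$ be inverse uniformly monotone with supercoercivity modulus $\eta$. Let $b,c \in X$ with $\|b\|\leq L_1$, $\|c\|\leq L_2$ and $\|Ab\| \leq L_3$. Then, for all $a \in X$, $$\langle a-c,Ab-Aa \rangle \leq \Theta(\eta,L_1,L_2,L_3).$$
   Context: Let $X$ be a real Hilbert space. A mapping $A:X\to X$ is inverse uniformly monotone if $A^{-1}$ (the inverse of its graph) is uniformly monotone; equivalently, there is $\psi:(0,\infty)\to(0,\infty)$ such that for all $\varepsilon>0$ and all $x,y\in X$ with $\|Ax-Ay\|\ge\varepsilon$, $\langle x-y,Ax-Ay\rangle\ge\psi(\varepsilon)$. Such an $A$ has supercoercivity modulus $\eta:(0,\infty)\to(0,\infty)$ if for all $N>0$ and all $x,y\in X$ with $\|Ax-Ay\|\ge\eta(N)$, one has $\langle x-y,Ax-Ay\rangle\ge N\|Ax-Ay\|$. *)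

theory Defs
  imports "HOL-Analysis.Analysis"
begin

text \<open>A set-valued operator is represented by its graph. Functions
  \<open>(0,\<infinity>) \<rightarrow> (0,\<infinity>)\<close> are total functions on the reals that map positive arguments to
  positive values; their values elsewhere are irrelevant.\<close>

definition uniformly_monotone :: "('a::real_inner \<times> 'a) set \<Rightarrow> bool" where
  "uniformly_monotone B \<longleftrightarrow>
    (\<exists>\<psi>\<in>{0::real<..} \<rightarrow> {0::real<..}. \<forall>\<epsilon>>0. \<forall>(x, u)\<in>B. \<forall>(y, v)\<in>B.
       norm (x - y) \<ge> \<epsilon> \<longrightarrow> (x - y) \<bullet> (u - v) \<ge> \<psi> \<epsilon>)"

definition graph_of :: "('a \<Rightarrow> 'b) \<Rightarrow> ('a \<times> 'b) set" where
  "graph_of A = {(x, A x) | x. True}"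

definition inverse_uniformly_monotone :: "('a::real_inner \<Rightarrow> 'a) \<Rightarrow> bool" where
  "inverse_uniformly_monotone A \<longleftrightarrow> uniformly_monotone ((graph_of A)\<inverse>)"

lemma inverse_uniformly_monotone_iff:
  "inverse_uniformly_monotone A \<longleftrightarrow>
    (\<exists>\<psi>\<in>{0::real<..} \<rightarrow> {0::real<..}. \<forall>\<epsilon>>0. \<forall>x y.
       norm (A x - A y) \<ge> \<epsilon> \<longrightarrow> (x - y) \<bullet> (A x - A y) \<ge> \<psi> \<epsilon>)"
proof -
  have "(graph_of A)\<inverse> = range (\<lambda>x. (A x, x))"
    by (auto simp: graph_of_def)
  then show ?thesis
    by (simp add: inverse_uniformly_monotone_def uniformly_monotone_def inner_commute)
qed

definition supercoercivity_modulus :: "('a::real_inner \<Rightarrow> 'a) \<Rightarrow> (real \<Rightarrow> real) \<Rightarrow> bool" where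
  "supercoercivity_modulus A \<eta> \<longleftrightarrow>
    \<eta> \<in> {0<..} \<rightarrow> {0<..} \<and>
    (\<forall>N>0. \<forall>x y. norm (A x - A y) \<ge> \<eta> N \<longrightarrow>
       (x - y) \<bullet> (A x - A y) \<ge> N * norm (A x - A y))"

definition rho :: "(real \<Rightarrow> real) \<Rightarrow> real \<Rightarrow> real \<Rightarrow> real \<Rightarrow> real" where
  "rho \<eta> L1 L2 L3 = 2 * L3 + L1 * L3 + \<eta> (2 * L1 + 2 * L2 + 2)"

definition Theta :: "(real \<Rightarrow> real) \<Rightarrow> real \<Rightarrow> real \<Rightarrow> real \<Rightarrow> real" where
  "Theta \<eta> L1 L2 L3 = (L1 + L2) * (L3 + rho \<eta> L1 L2 L3)"

end

(* Write (a - c) . (Ab - Aa) = (b - c) . (Ab - Aa) - (a - b) . (Aa - Ab), and let D = |Aa - Ab|.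
   The first term is at most (L1 + L2) D. If D is below \<eta> N with N = 2 L1 + 2 L2 + 2, drop the
   second term by monotonicity; otherwise the second term is at least N D and absorbs the first. *)
theory Submission
  imports Defs
begin

text \<open>When the images differ, their distance itself can serve as \<epsilon>, and \<psi> is
  positive there; when they coincide, the inner product vanishes.\<close>

lemma inverse_uniformly_monotone_imp_monotone:
  assumes "inverse_uniformly_monotone A"
  shows "(x - y) \<bullet> (A x - A y) \<ge> 0"
proof (cases "A x = A y")
  case False
  obtain \<psi> where \<psi>: "\<psi> \<in> {0::real<..} \<rightarrow> {0::real<..}"
    "\<And>\<epsilon> x y. \<epsilon> > 0 \<Longrightarrow> norm (A x - A y) \<ge> \<epsilon> \<Longrightarrow> (x - y) \<bullet> (A x - A y) \<ge> \<psi> \<epsilon>"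
    using assms unfolding inverse_uniformly_monotone_iff by blast
  let ?d = "norm (A x - A y)"
  have "?d > 0" using False by simp
  then have "\<psi> ?d > 0" and "(x - y) \<bullet> (A x - A y) \<ge> \<psi> ?d"
    using \<psi>(1) \<psi>(2)[of ?d x y] by auto
  then show ?thesis by linarith
qed simp

theorem proposition4p5:
  fixes A :: "'a::{real_inner, complete_space} \<Rightarrow> 'a"
    and \<eta> :: "real \<Rightarrow> real" and L1 L2 L3 :: real and b c :: 'a
  assumes "\<eta> \<in> {0<..} \<rightarrow> {0<..}"
    and "L1 > 0" and "L2 > 0" and "L3 > 0"
    and "inverse_uniformly_monotone A"
    and "supercoercivity_modulus A \<eta>"
    and "norm b \<le> L1" and "norm c \<le> L2" and "norm (A b) \<le> L3"
  shows "\<forall>a. (a - c) \<bullet> (A b - A a) \<le> Theta \<eta> L1 L2 L3"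
proof
  fix a
  \<comment> \<open>The argument at which \<open>rho\<close> evaluates \<eta>.\<close>
  define N where "N = 2 * L1 + 2 * L2 + 2"
  define D where "D = norm (A a - A b)"
  have D: "D \<ge> 0" by (simp add: D_def)
  have N: "N > 0" "L1 + L2 \<le> N" using assms(2,3) by (simp_all add: N_def)
  have \<eta>: "\<eta> N > 0" using assms(1) N by auto
  \<comment> \<open>Besides \<open>\<eta> N\<close>, the right-hand side consists of
    \<open>3 * L3 + L1 * L3\<close>, which is positive.\<close>
  have "\<eta> N \<le> L3 + rho \<eta> L1 L2 L3"
    using assms(2,4) by (simp add: rho_def N_def)
  then have \<Theta>: "(L1 + L2) * \<eta> N \<le> Theta \<eta> L1 L2 L3"
    using assms(2,3) unfolding Theta_def by (intro mult_left_mono) auto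
  have split: "(a - c) \<bullet> (A b - A a) = (b - c) \<bullet> (A b - A a) - (a - b) \<bullet> (A a - A b)"
    by (simp add: inner_diff_left inner_diff_right)
  have "(b - c) \<bullet> (A b - A a) \<le> norm (b - c) * norm (A b - A a)"
    by (rule norm_cauchy_schwarz)
  also have "\<dots> \<le> (L1 + L2) * D"
    unfolding D_def using norm_triangle_ineq4[of b c] assms(7,8)
    by (simp add: norm_minus_commute mult_right_mono)
  finally have bc: "(b - c) \<bullet> (A b - A a) \<le> (L1 + L2) * D" .
  show "(a - c) \<bullet> (A b - A a) \<le> Theta \<eta> L1 L2 L3"
  proof (cases "D \<ge> \<eta> N")
    case True
    then have "(a - b) \<bullet> (A a - A b) \<ge> N * D"
      using assms(6) N(1) unfolding supercoercivity_modulus_def D_def by blast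
    moreover have "(L1 + L2) * D \<le> N * D"
      using N(2) D by (rule mult_right_mono)
    \<comment> \<open>The two bounds above make the right-hand side of \<open>split\<close> at most
      0, so it remains to see that \<open>Theta\<close> is nonnegative; this follows through
      \<open>\<Theta>\<close>.\<close>
    moreover have "0 \<le> (L1 + L2) * \<eta> N"
      using assms(2,3) \<eta> by simp
    ultimately show ?thesis using split bc \<Theta> by linarith
  next
    case False
    \<comment> \<open>The Cauchy-Schwarz bound \<open>bc\<close> thus stays below the lower bound
      for \<open>Theta\<close> in \<open>\<Theta>\<close>.\<close>
    then have "(L1 + L2) * D \<le> (L1 + L2) * \<eta> N"
      using assms(2,3) by (intro mult_left_mono) auto
    moreover have "(a - b) \<bullet> (A a - A b) \<ge> 0"
      using assms(5) by (rule inverse_uniformly_monotone_imp_monotone)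
    ultimately show ?thesis using split bc \<Theta> by linarith
  qed
qed

end
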